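(* Define the matrix $\widetilde{\mathbb{M}}=\widetilde{\mathbf L}^*\mathbf A\,\widetilde{\mathbf U}\in\mathbb{C}^{N_q\times N_p}$. Then, for $1\le k\le N_q$ and $1\le j\le N_p$, the $(k,j)$ entry of $\widetilde{\mathbb{M}}$ is $$ \widetilde{\mathbb{M}}_{k,j}=\begin{cases}-\phi_k\rho_j\dfrac{\mathrm{i}\omega_kH(\mathrm{i}\omega_k)-\mathrm{i}\zeta_jH(\mathrm{i}\zeta_j)}{\mathrm{i}\omega_k-\mathrm{i}\zeta_j}, & 1\le k\le\ell_q,\ 1\le j\le\ell_p,\\[2mm] \phi_k\rho_\infty\left(\mathrm{i}\omega_kH(\mathrm{i}\omega_k)-M_0\right), & 1\le k\le\ell_q,\ j=N_p=\ell_p+1,\\[1mm] \phi_\infty\rho_j\left(\mathrm{i}\zeta_jH(\mathrm{i}\zeta_j)-M_0\right), & k=N_q=\ell_q+1,\ 1\le j\le\ell_p,\\[1mm] \phi_\infty\rho_\infty M_1, & k=N_q=\ell_q+1,\ j=N_p=\ell_p+1.\end{cases} $$ Likewise, defining $\widetilde{\mathbf h}=\widetilde{\mathbf L}^*\mathbf b\in\mathbb{C}^{N_q\times1}$ and $\widetilde{\mathbf g}^T=\mathbf c^T\widetilde{\mathbf U}\in\mathbb{C}^{1\times N_p}$, one has $$\widetilde{\mathbf h}_k=\begin{cases}\phi_kH(\mathrm{i}\omega_k), & 1\le k\le\ell_q,\\ \phi_\infty M_0, & k=N_q=\ell_q+1,\end{cases}\qquad\text{and}\qquad \widetilde{\mathbf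 g}_j=\begin{cases}\rho_jH(\mathrm{i}\zeta_j), & 1\le j\le\ell_p,\\ \rho_\infty M_0, & j=N_p=\ell_p+1.\end{cases}$$
   Context: Let $\mathbf E,\mathbf A\in\mathbb{R}^{n\times n}$ and $\mathbf b,\mathbf c\in\mathbb{R}^n$, with $\mathbf E$ nonsingular and the pencil $(\mathbf A,\mathbf E)$ asymptotically stable, i.e. all eigenvalues of $\mathbf E^{-1}\mathbf A$ lie in the open left half-plane. The transfer function is $H(s)=\mathbf c^T(s\mathbf E-\mathbf A)^{-1}\mathbf b$, and the leading two Markov parameters are $M_0=\mathbf c^T\mathbf E^{-1}\mathbf b$ and $M_1=\mathbf c^T\mathbf E^{-1}\mathbf A\mathbf E^{-1}\mathbf b$. Here $\mathrm{i}^2=-1$. Let $\zeta_1,\dots,\zeta_{\ell_p}\in\mathbb{R}$ and $\omega_1,\dots,\omega_{\ell_q}\in\mathbb{R}$ be quadrature nodes, with $\omega_k\neq\zeta_j$ for all $k,j$, and let $\rho_j^2$, $\phi_k^2$ be the corresponding quadrature weights ($\rho_j,\phi_k$ real). Each of the two quadrature rules may in addition contain a "node at infinity" with weight $\rho_\infty^2$ (resp. $\phi_\infty^2$), where $\rho_\infty,\phi_\infty$ are real. The total number of nodes is $N_p=\ell_p$ if the node at infinity is absent from the first rule and $N_p=\ell_p+1$ if it is present; likewise $N_q=\ell_q$ or $N_q=\ell_q+1$ for the second rule. Define $$\widetilde{\mathbf U}=\big[\rho_1(\mathrm{i}\zeta_1\mathbf E-\mathbf A)^{-1}\mathbf b\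 \ \cdots\ \ \rho_{\ell_p}(\mathrm{i}\zeta_{\ell_p}\mathbf E-\mathbf A)^{-1}\mathbf b\ \ \ \rho_\infty\mathbf E^{-1}\mathbf b\big]\in\mathbb{C}^{n\times N_p},$$ $$\widetilde{\mathbf L}^*=\begin{bmatrix}\phi_1\mathbf c^T(\mathrm{i}\omega_1\mathbf E-\mathbf A)^{-1}\\ \vdots\\ \phi_{\ell_q}\mathbf c^T(\mathrm{i}\omega_{\ell_q}\mathbf E-\mathbf A)^{-1}\\ \phi_\infty\mathbf c^T\mathbf E^{-1}\end{bmatrix}\in\mathbb{C}^{N_q\times n},$$ where the last column of $\widetilde{\mathbf U}$ (resp. last row of $\widetilde{\mathbf L}^*$) is omitted if the corresponding node at infinity is absent. Cases in the claim referring to an index $j=\ell_p+1$ or $k=\ell_q+1$ apply only when the corresponding node at infinity is present. ${}^*$ denotes conjugate transpose. *)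

theory Defs
  imports
    "Jordan_Normal_Form.Gauss_Jordan_Elimination"
    "Jordan_Normal_Form.Char_Poly"
    Complex_Main
begin

abbreviation cmat :: "real mat \<Rightarrow> complex mat" where
  "cmat \<equiv> map_mat complex_of_real"

abbreviation cvec :: "real vec \<Rightarrow> complex vec" where
  "cvec \<equiv> map_vec complex_of_real"

(* Unspecified on singular matrices. *)
definition mat_inv :: "'a :: field mat \<Rightarrow> 'a mat" where
  "mat_inv X = the (mat_inverse X)"

(* The row vector c^T X, stored as a vector of dimension dim_col X. *)
definition row_times :: "'a :: semiring_0 vec \<Rightarrow> 'a mat \<Rightarrow> 'a vec" where
  "row_times c X = row (mat_of_row c * X) 0"

definition asymptotically_stable :: "real mat \<Rightarrow> real mat \<Rightarrow> bool" where
  "asymptotically_stable A E \<longleftrightarrow>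
     (\<forall>\<mu>. eigenvalue (cmat (mat_inv E * A)) \<mu> \<longrightarrow> Re \<mu> < 0)"

definition resolvent :: "real mat \<Rightarrow> real mat \<Rightarrow> complex \<Rightarrow> complex mat" where
  "resolvent E A s = mat_inv (s \<cdot>\<^sub>m cmat E - cmat A)"

(* In Jordan_Normal_Form the scalar product \<bullet> is bilinear (no conjugation),
   so c \<bullet> x is c^T x. *)
definition transfer_function ::
  "real mat \<Rightarrow> real mat \<Rightarrow> real vec \<Rightarrow> real vec \<Rightarrow> complex \<Rightarrow> complex" where
  "transfer_function E A b c s = cvec c \<bullet> (resolvent E A s *\<^sub>v cvec b)"

definition markov0 :: "real mat \<Rightarrow> real vec \<Rightarrow> real vec \<Rightarrow> real" where
  "markov0 E b c = c \<bullet> (mat_inv E *\<^sub>v b)"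

definition markov1 :: "real mat \<Rightarrow> real mat \<Rightarrow> real vec \<Rightarrow> real vec \<Rightarrow> real" where
  "markov1 E A b c = c \<bullet> ((mat_inv E * A * mat_inv E) *\<^sub>v b)"

(* A quadrature rule has l finite nodes, indexed 0, ..., l - 1 (where the
   mathematics counts from 1).
   The node at infinity, if present, has the last index l. *)
definition num_nodes :: "nat \<Rightarrow> bool \<Rightarrow> nat" where
  "num_nodes l at_inf = (if at_inf then l + 1 else l)"

(* rho, rho_inf (and phi, phi_inf below) are the square roots of the weights. *)
definition U_tilde ::
  "real mat \<Rightarrow> real mat \<Rightarrow> real vec \<Rightarrow> nat \<Rightarrow> (nat \<Rightarrow> real) \<Rightarrow> (nat \<Rightarrow> real) \<Rightarrow>
   bool \<Rightarrow> real \<Rightarrow> complex mat" where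
  "U_tilde E A b lp \<zeta> \<rho> p_inf \<rho>_inf = mat_of_cols (dim_row E)
     (map (\<lambda>j. complex_of_real (\<rho> j) \<cdot>\<^sub>v
                (resolvent E A (\<i> * complex_of_real (\<zeta> j)) *\<^sub>v cvec b)) [0..<lp]
      @ (if p_inf then [cvec (\<rho>_inf \<cdot>\<^sub>v (mat_inv E *\<^sub>v b))] else []))"

definition L_tilde_star ::
  "real mat \<Rightarrow> real mat \<Rightarrow> real vec \<Rightarrow> nat \<Rightarrow> (nat \<Rightarrow> real) \<Rightarrow> (nat \<Rightarrow> real) \<Rightarrow>
   bool \<Rightarrow> real \<Rightarrow> complex mat" where
  "L_tilde_star E A c lq \<omega> \<phi> q_inf \<phi>_inf = mat_of_rows (dim_row E)
     (map (\<lambda>k. complex_of_real (\<phi> k) \<cdot>\<^sub>v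
                row_times (cvec c) (resolvent E A (\<i> * complex_of_real (\<omega> k)))) [0..<lq]
      @ (if q_inf then [cvec (\<phi>_inf \<cdot>\<^sub>v row_times c (mat_inv E))] else []))"

end

theory Submission
  imports Defs
begin

text \<open>
  With $F = E^{-1}$ and $R(s) = (sE - A)^{-1}$, every column of $U$ is a real factor times $Y b$ and
  every row of $L^*$ a real factor times $c^T X$, where $X$ and $Y$ are resolvents at finite nodes and
  $F$ at a node at infinity. Every entry of $M$ is therefore two such factors times
  $c^T X A Y b$, and the four cases come from the four products $X A Y$. Each product is rewritten
  by replacing $A$ with $sE - (sE - A)$ next to a resolvent $R(s)$: multiplying
  $(sE - A) R(s) = 1$ from the left by $X$ gives $X A R(s) = s\,X E R(s) - X$.

  If the other factor is $F$, then $E$ cancels and $F A R(s) = s R(s) - F$; symmetrically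
  $R(s) A F = s R(s) - F$. If it is a resolvent, the unknown $R(w) E R(z)$ occurs in two such
  equations, one from each side, and eliminating it gives
  $(w - z) R(w) A R(z) = z R(z) - w R(w)$. Sandwiching these identities between $c^T$ and $b$ turns
  $R(s)$ into $H(s)$, and $F$ into $M_0$. For two nodes at infinity the product $F A F$ is the one
  that defines $M_1$.

  Stability ensures that $R(s)$ is a true inverse at $s = \mathrm{i}\zeta_j$ and
  $s = \mathrm{i}\omega_k$: a kernel vector of $sE - A$ is an eigenvector of $E^{-1}A$ for the
  eigenvalue $s$, which is impossible on the imaginary axis.
\<close>

section \<open>Inverses and resolvents\<close>

lemma smult_mat_mult_vec:
  fixes X :: "'a :: comm_semiring_0 mat"
  assumes "X \<in> carrier_mat m n" and "v \<in> carrier_vec n"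
  shows "(s \<cdot>\<^sub>m X) *\<^sub>v v = s \<cdot>\<^sub>v (X *\<^sub>v v)"
  using assms by (intro eq_vecI) (auto simp: carrier_vecD)

lemma mat_inv_of_det_nonzero:
  fixes X :: "'a :: field mat"
  assumes X: "X \<in> carrier_mat n n" and det: "det X \<noteq> 0"
  shows "mat_inv X \<in> carrier_mat n n" "X * mat_inv X = 1\<^sub>m n" "mat_inv X * X = 1\<^sub>m n"
proof -
  have "X \<in> Units (ring_mat TYPE('a) n ())"
    using det_non_zero_imp_unit[OF X det] .
  then obtain Y where "mat_inverse X = Some Y"
    using mat_inverse(1)[OF X, of "()"] by (cases "mat_inverse X") auto
  then show "mat_inv X \<in> carrier_mat n n" "X * mat_inv X = 1\<^sub>m n" "mat_inv X * X = 1\<^sub>m n"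
    using mat_inverse(2)[OF X] by (auto simp: mat_inv_def)
qed

lemma invertible_mat_det_nonzero:
  fixes X :: "'a :: field mat"
  assumes X: "X \<in> carrier_mat n n" and inv: "invertible_mat X"
  shows "det X \<noteq> 0"
proof
  assume "det X = 0"
  then obtain v where v: "v \<in> carrier_vec n" "v \<noteq> 0\<^sub>v n" "X *\<^sub>v v = 0\<^sub>v n"
    using det_0_iff_vec_prod_zero[OF X] by blast
  obtain Y where XY: "inverts_mat X Y" and YX: "inverts_mat Y X"
    using inv by (auto simp: invertible_mat_def)
  have "dim_col Y = n"
    using arg_cong[OF XY[unfolded inverts_mat_def], of dim_col] X by simp
  moreover have "dim_row Y = n"
    using arg_cong[OF YX[unfolded inverts_mat_def], of dim_col] X by simp
  ultimately have Y: "Y \<in> carrier_mat n n" by auto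
  have "v = (Y * X) *\<^sub>v v"
    using YX Y v(1) by (simp add: inverts_mat_def)
  also have "\<dots> = Y *\<^sub>v 0\<^sub>v n"
    using Y X v by simp
  also have "\<dots> = 0\<^sub>v n"
    using Y by auto
  finally show False using v(2) by simp
qed

lemma cmat_mat_inv:
  assumes E: "E \<in> carrier_mat n n" and inv: "invertible_mat E"
  shows "mat_inv E \<in> carrier_mat n n"
    and "cmat E * cmat (mat_inv E) = 1\<^sub>m n" "cmat (mat_inv E) * cmat E = 1\<^sub>m n"
proof -
  note F = mat_inv_of_det_nonzero[OF E invertible_mat_det_nonzero[OF E inv]]
  show "mat_inv E \<in> carrier_mat n n" by (rule F)
  show "cmat E * cmat (mat_inv E) = 1\<^sub>m n" "cmat (mat_inv E) * cmat E = 1\<^sub>m n"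
    by (simp_all add: of_real_hom.mat_hom_mult[symmetric, OF E F(1)]
        of_real_hom.mat_hom_mult[symmetric, OF F(1) E] F of_real_hom.mat_hom_one)
qed

text \<open>
  A kernel vector $v$ of $sE - A$ satisfies $E^{-1}A v = s v$, and stability excludes such an
  eigenvalue in the closed right half-plane.
\<close>

lemma stable_pencil_det_nonzero:
  assumes E: "E \<in> carrier_mat n n" and A: "A \<in> carrier_mat n n"
    and inv: "invertible_mat E" and stable: "asymptotically_stable A E" and s: "Re s \<ge> 0"
  shows "det (s \<cdot>\<^sub>m cmat E - cmat A) \<noteq> 0"
proof
  let ?P = "s \<cdot>\<^sub>m cmat E - cmat A"
  let ?F = "cmat (mat_inv E)"
  note F = cmat_mat_inv[OF E inv]
  have Ec: "cmat E \<in> carrier_mat n n" and Ac: "cmat A \<in> carrier_mat n n"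
    and Fc: "?F \<in> carrier_mat n n"
    using E A F(1) by auto
  have P: "?P \<in> carrier_mat n n" using Ac by auto
  assume "det ?P = 0"
  then obtain v where v: "v \<in> carrier_vec n" "v \<noteq> 0\<^sub>v n" "?P *\<^sub>v v = 0\<^sub>v n"
    using det_0_iff_vec_prod_zero[OF P] by blast
  have FP: "?F * ?P = s \<cdot>\<^sub>m 1\<^sub>m n - ?F * cmat A"
    using Ec Ac Fc
    by (simp add: mult_minus_distrib_mat[of _ n n _ n] mult_smult_distrib[of _ n n _ n] F)
  have FA: "?F * cmat A \<in> carrier_mat n n" using Fc Ac by simp
  have "(?F * ?P) *\<^sub>v v = ?F *\<^sub>v (?P *\<^sub>v v)"
    using Fc P v(1) by (rule assoc_mult_mat_vec)
  also have "\<dots> = 0\<^sub>v n" using v(3) Fc by auto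
  finally have "s \<cdot>\<^sub>v v - (?F * cmat A) *\<^sub>v v = 0\<^sub>v n"
    unfolding FP
    using FA v(1) by (simp add: minus_mult_distrib_mat_vec[of _ n n] smult_mat_mult_vec[of _ n n]
        del: assoc_mult_mat_vec)
  then have "(?F * cmat A) *\<^sub>v v = s \<cdot>\<^sub>v v"
    using FA v(1) by (auto simp: vec_eq_iff simp del: assoc_mult_mat_vec)
  then have "eigenvalue (cmat (mat_inv E * A)) s"
    using v(1,2) F(1) A
    by (auto simp: eigenvalue_def eigenvector_def of_real_hom.mat_hom_mult[OF F(1) A]
        simp del: assoc_mult_mat_vec)
  then show False
    using stable s by (auto simp: asymptotically_stable_def)
qed

section \<open>Products of the form resolvent, state matrix, resolvent\<close>

text \<open>
  Writing $A = sE - (sE - A)$, the second summand cancels against \<open>R\<close>. The free factor \<open>X\<close> will be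
  $E^{-1}$ for a node at infinity and a second resolvent for a finite node.
\<close>

lemma mult_A_right_inverse_pencil:
  fixes E A R X :: "'a :: comm_ring_1 mat"
  assumes E: "E \<in> carrier_mat n n" and A: "A \<in> carrier_mat n n" and R: "R \<in> carrier_mat n n"
    and X: "X \<in> carrier_mat n n" and inv: "(s \<cdot>\<^sub>m E - A) * R = 1\<^sub>m n"
  shows "X * A * R = s \<cdot>\<^sub>m (X * E * R) - X"
proof -
  have XE: "X * E \<in> carrier_mat n n" and XA: "X * A \<in> carrier_mat n n"
    and P: "s \<cdot>\<^sub>m E - A \<in> carrier_mat n n"
    using X E A by auto
  have "X = X * ((s \<cdot>\<^sub>m E - A) * R)"
    using X inv by simp
  also have "\<dots> = X * (s \<cdot>\<^sub>m E - A) * R"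
    using X P R by simp
  also have "\<dots> = s \<cdot>\<^sub>m (X * E * R) - X * A * R"
    using XE XA X E A R
    by (simp add: mult_minus_distrib_mat[of _ n n _ n] minus_mult_distrib_mat[of _ n n _ _ n]
        mult_smult_distrib[of _ n n _ n] mult_smult_assoc_mat[of _ n n _ n] del: assoc_mult_mat)
  finally have eq: "X = s \<cdot>\<^sub>m (X * E * R) - X * A * R" .
  show ?thesis
  proof (rule eq_matI)
    fix i j assume "i < dim_row (s \<cdot>\<^sub>m (X * E * R) - X)" "j < dim_col (s \<cdot>\<^sub>m (X * E * R) - X)"
    then have ij: "i < n" "j < n" using X by auto
    show "(X * A * R) $$ (i, j) = (s \<cdot>\<^sub>m (X * E * R) - X) $$ (i, j)"
      using arg_cong[OF eq, of "\<lambda>M. M $$ (i, j)"] ij X E A R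
      by (simp add: algebra_simps del: assoc_mult_mat index_mult_mat(1))
  qed (use X A R in auto)
qed

text \<open>Transposition reduces this to the preceding identity for the transposed pencil.\<close>

lemma left_inverse_pencil_mult_A:
  fixes E A Q X :: "'a :: comm_ring_1 mat"
  assumes E: "E \<in> carrier_mat n n" and A: "A \<in> carrier_mat n n" and Q: "Q \<in> carrier_mat n n"
    and X: "X \<in> carrier_mat n n" and inv: "Q * (s \<cdot>\<^sub>m E - A) = 1\<^sub>m n"
  shows "Q * A * X = s \<cdot>\<^sub>m (Q * E * X) - X"
proof -
  let ?t = "transpose_mat"
  have P: "s \<cdot>\<^sub>m E - A \<in> carrier_mat n n" using A by auto
  have tP: "?t (s \<cdot>\<^sub>m E - A) = s \<cdot>\<^sub>m ?t E - ?t A"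
    using E A by (intro eq_matI) auto
  have "(s \<cdot>\<^sub>m ?t E - ?t A) * ?t Q = 1\<^sub>m n"
    using arg_cong[OF inv, of ?t] transpose_mult[OF Q P] tP by simp
  from mult_A_right_inverse_pencil[OF _ _ _ _ this, of "?t X"]
  have "?t X * ?t A * ?t Q = s \<cdot>\<^sub>m (?t X * ?t E * ?t Q) - ?t X"
    using E A Q X by simp
  moreover have "?t X * ?t Y * ?t Q = ?t (Q * Y * X)" if "Y \<in> carrier_mat n n" for Y
    using that Q X by (simp add: transpose_mult[of _ n n _ n] assoc_mult_mat[of _ n n _ n _ n])
  ultimately have "?t (Q * A * X) = s \<cdot>\<^sub>m ?t (Q * E * X) - ?t X"
    using E A by simp
  also have "\<dots> = ?t (s \<cdot>\<^sub>m (Q * E * X) - X)"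
    using Q E X by (intro eq_matI) auto
  finally show ?thesis by simp
qed

text \<open>
  Both preceding identities apply and express \<open>Q * A * R\<close> through \<open>Q * E * R\<close>, with the factors
  \<open>z\<close> and \<open>w\<close> respectively; the combination with coefficients \<open>w\<close> and \<open>-z\<close> eliminates \<open>Q * E * R\<close>.
\<close>

lemma pencil_inverses_sandwich_A:
  fixes E A Q R :: "'a :: comm_ring_1 mat"
  assumes E: "E \<in> carrier_mat n n" and A: "A \<in> carrier_mat n n"
    and Q: "Q \<in> carrier_mat n n" and R: "R \<in> carrier_mat n n"
    and Qinv: "Q * (w \<cdot>\<^sub>m E - A) = 1\<^sub>m n" and Rinv: "(z \<cdot>\<^sub>m E - A) * R = 1\<^sub>m n"
  shows "(w - z) \<cdot>\<^sub>m (Q * A * R) = z \<cdot>\<^sub>m R - w \<cdot>\<^sub>m Q"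
proof (rule eq_matI)
  fix i j assume "i < dim_row (z \<cdot>\<^sub>m R - w \<cdot>\<^sub>m Q)" "j < dim_col (z \<cdot>\<^sub>m R - w \<cdot>\<^sub>m Q)"
  then have ij: "i < n" "j < n" using Q by auto
  define x y where "x = (Q * A * R) $$ (i, j)" and "y = (Q * E * R) $$ (i, j)"
  have 1: "x = z * y - Q $$ (i, j)"
    using arg_cong[OF mult_A_right_inverse_pencil[OF E A R Q Rinv], of "\<lambda>M. M $$ (i, j)"]
      ij Q E A R by (simp add: x_def y_def del: assoc_mult_mat index_mult_mat(1))
  have 2: "x = w * y - R $$ (i, j)"
    using arg_cong[OF left_inverse_pencil_mult_A[OF E A Q R Qinv], of "\<lambda>M. M $$ (i, j)"]
      ij Q E A R by (simp add: x_def y_def del: assoc_mult_mat index_mult_mat(1))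
  have "(w - z) * x = w * (z * y - Q $$ (i, j)) - z * (w * y - R $$ (i, j))"
    using 1 2 by (metis left_diff_distrib)
  then have "(w - z) * x = z * R $$ (i, j) - w * Q $$ (i, j)"
    by (simp add: algebra_simps)
  then show "((w - z) \<cdot>\<^sub>m (Q * A * R)) $$ (i, j) = (z \<cdot>\<^sub>m R - w \<cdot>\<^sub>m Q) $$ (i, j)"
    using ij Q A R by (simp add: x_def del: assoc_mult_mat index_mult_mat(1))
qed (use Q A R in auto)

section \<open>Rows, columns and entries\<close>

lemma row_times_carrier:
  assumes "X \<in> carrier_mat m n"
  shows "row_times c X \<in> carrier_vec n"
  using assms by (simp add: row_times_def carrier_vecI)

lemma row_times_index:
  assumes "j < dim_col X"
  shows "row_times c X $ j = c \<bullet> col X j"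
  using assms by (simp add: row_times_def)

lemma row_times_scalar_prod:
  fixes c :: "'a :: comm_semiring_1 vec"
  assumes c: "c \<in> carrier_vec m" and X: "X \<in> carrier_mat m n" and v: "v \<in> carrier_vec n"
  shows "row_times c X \<bullet> v = c \<bullet> (X *\<^sub>v v)"
proof -
  have "row_times c X = transpose_mat X *\<^sub>v c"
    using c X
    by (intro eq_vecI) (auto simp: row_times_def comm_scalar_prod[of c m])
  then show ?thesis
    using transpose_vec_mult_scalar[OF X v c] by simp
qed

lemma cvec_row_times:
  assumes "c \<in> carrier_vec m" and "X \<in> carrier_mat m n"
  shows "cvec (row_times c X) = row_times (cvec c) (cmat X)"
  using assms
  by (intro eq_vecI) (auto simp: row_times_def scalar_prod_def)

lemma of_real_scalar_prod_mult:
  assumes "c \<in> carrier_vec m" and "X \<in> carrier_mat m n" and "b \<in> carrier_vec n"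
  shows "complex_of_real (c \<bullet> (X *\<^sub>v b)) = cvec c \<bullet> (cmat X *\<^sub>v cvec b)"
  using assms
  by (simp add: of_real_hom.mult_mat_vec_hom[symmetric, of _ m n]) (simp add: scalar_prod_def)

text \<open>
  All four cases of the entry formula go through this reduction; they differ only in the choice
  of \<open>X\<close>, \<open>Y\<close> and the two factors.
\<close>

lemma entry_of_weighted_sandwich:
  fixes c b :: "'a :: field vec"
  assumes L: "L \<in> carrier_mat q n" and A: "A \<in> carrier_mat n n" and U: "U \<in> carrier_mat n p"
    and X: "X \<in> carrier_mat n n" and Y: "Y \<in> carrier_mat n n"
    and c: "c \<in> carrier_vec n" and b: "b \<in> carrier_vec n" and k: "k < q" and j: "j < p"
    and row: "row L k = f \<cdot>\<^sub>v row_times c X" and col: "col U j = r \<cdot>\<^sub>v (Y *\<^sub>v b)"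
  shows "(L * A * U) $$ (k, j) = f * r * (c \<bullet> ((X * A * Y) *\<^sub>v b))"
proof -
  have Yb: "Y *\<^sub>v b \<in> carrier_vec n" and AYb: "A *\<^sub>v (Y *\<^sub>v b) \<in> carrier_vec n"
    using Y A b by auto
  have cX: "row_times c X \<in> carrier_vec n" by (rule row_times_carrier[OF X])
  have "(L * A * U) $$ (k, j) = (L * (A * U)) $$ (k, j)"
    using L A U by simp
  also have "\<dots> = row L k \<bullet> (A *\<^sub>v col U j)"
    using L A U k j col_mult2[OF A U j] by simp
  also have "A *\<^sub>v col U j = r \<cdot>\<^sub>v (A *\<^sub>v (Y *\<^sub>v b))"
    unfolding col by (rule mult_mat_vec[OF A Yb])
  also have "row L k \<bullet> (r \<cdot>\<^sub>v (A *\<^sub>v (Y *\<^sub>v b))) = f * r * (row_times c X \<bullet> (A *\<^sub>v (Y *\<^sub>v b)))"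
    unfolding row using cX AYb by (simp add: carrier_vecD)
  also have "row_times c X \<bullet> (A *\<^sub>v (Y *\<^sub>v b)) = c \<bullet> (X *\<^sub>v (A *\<^sub>v (Y *\<^sub>v b)))"
    by (rule row_times_scalar_prod[OF c X AYb])
  also have "X *\<^sub>v (A *\<^sub>v (Y *\<^sub>v b)) = (X * A * Y) *\<^sub>v b"
    using assoc_mult_mat_vec[OF mult_carrier_mat[OF X A] Y b] assoc_mult_mat_vec[OF X A Yb] by simp
  finally show ?thesis .
qed

lemma nth_finite_nodes_then_infinity:
  assumes "j < num_nodes l at_inf"
  shows "(map f [0..<l] @ (if at_inf then [v] else [])) ! j = (if j < l then f j else v)"
  using assms by (auto simp: num_nodes_def nth_append less_Suc_eq split: if_splits)

section \<open>The projected matrices\<close>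

theorem proposition3p3:
  fixes n lp lq :: nat
    and E A :: "real mat" and b c :: "real vec"
    and \<zeta> \<rho> \<omega> \<phi> :: "nat \<Rightarrow> real"
    and p_inf q_inf :: bool and \<rho>_inf \<phi>_inf :: real
  assumes "E \<in> carrier_mat n n" and "A \<in> carrier_mat n n"
    and "b \<in> carrier_vec n" and "c \<in> carrier_vec n"
    and "invertible_mat E"
    and "asymptotically_stable A E"
    and "\<forall>k<lq. \<forall>j<lp. \<omega> k \<noteq> \<zeta> j"
  shows
    "let H = transfer_function E A b c;
         M0 = complex_of_real (markov0 E b c);
         M1 = complex_of_real (markov1 E A b c);
         Np = num_nodes lp p_inf;
         Nq = num_nodes lq q_inf;
         U = U_tilde E A b lp \<zeta> \<rho> p_inf \<rho>_inf;
         Lstar = L_tilde_star E A c lq \<omega> \<phi> q_inf \<phi>_inf;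
         M = Lstar * cmat A * U;
         h = Lstar *\<^sub>v cvec b;
         g = row_times (cvec c) U;
         z = (\<lambda>j. \<i> * complex_of_real (\<zeta> j));
         w = (\<lambda>k. \<i> * complex_of_real (\<omega> k))
     in U \<in> carrier_mat n Np \<and> Lstar \<in> carrier_mat Nq n \<and>
        M \<in> carrier_mat Nq Np \<and> h \<in> carrier_vec Nq \<and> g \<in> carrier_vec Np \<and>
        (\<forall>k<Nq. \<forall>j<Np. M $$ (k, j) =
           (if k < lq \<and> j < lp then
              - complex_of_real (\<phi> k) * complex_of_real (\<rho> j) *
                ((w k * H (w k) - z j * H (z j)) / (w k - z j))
            else if k < lq then
              complex_of_real (\<phi> k) * complex_of_real \<rho>_inf * (w k * H (w k) - M0)
            else if j < lp then
              complex_of_real \<phi>_inf * complex_of_real (\<rho> j) * (z j * H (z j) - M0)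
            else complex_of_real \<phi>_inf * complex_of_real \<rho>_inf * M1)) \<and>
        (\<forall>k<Nq. h $ k =
           (if k < lq then complex_of_real (\<phi> k) * H (w k)
            else complex_of_real \<phi>_inf * M0)) \<and>
        (\<forall>j<Np. g $ j =
           (if j < lp then complex_of_real (\<rho> j) * H (z j)
            else complex_of_real \<rho>_inf * M0))"
proof -
  note E = assms(1) and A = assms(2) and b = assms(3) and c = assms(4)
    and inv = assms(5) and stable = assms(6)
  define H where "H = transfer_function E A b c"
  define M0 where "M0 = complex_of_real (markov0 E b c)"
  define M1 where "M1 = complex_of_real (markov1 E A b c)"
  define Np where "Np = num_nodes lp p_inf"
  define Nq where "Nq = num_nodes lq q_inf"
  define U where "U = U_tilde E A b lp \<zeta> \<rho> p_inf \<rho>_inf"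
  define L where "L = L_tilde_star E A c lq \<omega> \<phi> q_inf \<phi>_inf"
  define z where "z = (\<lambda>j. \<i> * complex_of_real (\<zeta> j))"
  define w where "w = (\<lambda>k. \<i> * complex_of_real (\<omega> k))"
  define R where "R = resolvent E A"
  define F where "F = cmat (mat_inv E)"
  define \<beta> where "\<beta> X = cvec c \<bullet> (X *\<^sub>v cvec b)" for X
  note invE = cmat_mat_inv[OF E inv, folded F_def]
  have Ec: "cmat E \<in> carrier_mat n n" and Ac: "cmat A \<in> carrier_mat n n"
    and Fc: "F \<in> carrier_mat n n" and bc: "cvec b \<in> carrier_vec n" and cc: "cvec c \<in> carrier_vec n"
    using E A b c invE(1) by (auto simp: F_def)

  have R: "R s \<in> carrier_mat n n" "(s \<cdot>\<^sub>m cmat E - cmat A) * R s = 1\<^sub>m n"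
    "R s * (s \<cdot>\<^sub>m cmat E - cmat A) = 1\<^sub>m n" if "Re s = 0" for s
  proof -
    have P: "s \<cdot>\<^sub>m cmat E - cmat A \<in> carrier_mat n n" using Ac by auto
    show "R s \<in> carrier_mat n n" "(s \<cdot>\<^sub>m cmat E - cmat A) * R s = 1\<^sub>m n"
      "R s * (s \<cdot>\<^sub>m cmat E - cmat A) = 1\<^sub>m n"
      using mat_inv_of_det_nonzero[OF P stable_pencil_det_nonzero[OF E A inv stable]] that
      by (auto simp: R_def resolvent_def)
  qed
  have Re_nodes [simp]: "Re (z j) = 0" "Re (w j) = 0" for j
    by (simp_all add: z_def w_def)

  have \<beta>_minus: "\<beta> (X - Y) = \<beta> X - \<beta> Y"
    if "X \<in> carrier_mat n n" "Y \<in> carrier_mat n n" for X Y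
    using that bc cc
    by (simp add: \<beta>_def minus_mult_distrib_mat_vec[of _ n n] scalar_prod_minus_distrib[of _ n])
  have \<beta>_smult: "\<beta> (s \<cdot>\<^sub>m X) = s * \<beta> X" if "X \<in> carrier_mat n n" for s X
    using that bc cc
    by (simp add: \<beta>_def smult_mat_mult_vec[of _ n n])
  have \<beta>_R: "\<beta> (R s) = H s" for s
    by (simp add: \<beta>_def H_def transfer_function_def R_def)
  have \<beta>_F: "\<beta> F = M0"
    unfolding \<beta>_def M0_def markov0_def F_def
    by (rule of_real_scalar_prod_mult[OF c invE(1) b, symmetric])
  have \<beta>_FAF: "\<beta> (F * cmat A * F) = M1"
  proof -
    have FA: "mat_inv E * A \<in> carrier_mat n n" and FAF: "mat_inv E * A * mat_inv E \<in> carrier_mat n n"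
      using invE(1) A by auto
    have "M1 = \<beta> (cmat (mat_inv E * A * mat_inv E))"
      unfolding \<beta>_def M1_def markov1_def by (rule of_real_scalar_prod_mult[OF c FAF b])
    then show ?thesis
      by (simp add: F_def of_real_hom.mat_hom_mult[OF FA invE(1)] of_real_hom.mat_hom_mult[OF invE(1) A])
  qed

  have \<beta>_RAR: "\<beta> (R u * cmat A * R s) = - ((u * H u - s * H s) / (u - s))"
    if "Re u = 0" "Re s = 0" "u \<noteq> s" for u s
  proof -
    have RAR: "R u * cmat A * R s \<in> carrier_mat n n"
      using R(1)[OF that(1)] R(1)[OF that(2)] Ac by simp
    have "(u - s) * \<beta> (R u * cmat A * R s) = s * H s - u * H u"
      using arg_cong[OF pencil_inverses_sandwich_A[OF Ec Ac R(1) R(1) R(3) R(2), of u s], of \<beta>]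
        R(1)[of u] R(1)[of s] that
      by (simp add: \<beta>_minus \<beta>_smult \<beta>_smult[OF RAR] \<beta>_R del: assoc_mult_mat)
    then show ?thesis using that(3) by (simp add: field_simps)
  qed
  have \<beta>_RAF: "\<beta> (R s * cmat A * F) = s * H s - M0" if "Re s = 0" for s
  proof -
    have "R s * cmat E * F = R s"
      using R(1)[OF that] Ec Fc invE(2) by simp
    then show ?thesis
      using left_inverse_pencil_mult_A[OF Ec Ac R(1) Fc R(3), OF that that] R(1)[OF that] Fc
      by (simp add: \<beta>_minus \<beta>_smult \<beta>_R \<beta>_F del: assoc_mult_mat)
  qed
  have \<beta>_FAR: "\<beta> (F * cmat A * R s) = s * H s - M0" if "Re s = 0" for s
  proof -
    have "F * cmat E * R s = R s"
      using R(1)[OF that] invE(3) by simp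
    then show ?thesis
      using mult_A_right_inverse_pencil[OF Ec Ac R(1) Fc R(2), OF that that] R(1)[OF that] Fc
      by (simp add: \<beta>_minus \<beta>_smult \<beta>_R \<beta>_F del: assoc_mult_mat)
  qed

  \<comment> \<open>A node at infinity differs from a finite one only in having \<open>F\<close> in place of a resolvent, so
      one formula for the columns of \<open>U\<close> and one for the rows of \<open>L\<close> cover both kinds.\<close>
  define Y where "Y j = (if j < lp then R (z j) else F)" for j
  define X where "X k = (if k < lq then R (w k) else F)" for k
  define r where "r j = complex_of_real (if j < lp then \<rho> j else \<rho>_inf)" for j
  define f where "f k = complex_of_real (if k < lq then \<phi> k else \<phi>_inf)" for k
  have Yc: "Y j \<in> carrier_mat n n" and Xc: "X j \<in> carrier_mat n n" for j
    using R(1) Fc by (auto simp: Y_def X_def)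
  have Uc: "U \<in> carrier_mat n Np" and Lc: "L \<in> carrier_mat Nq n"
    using E by (auto simp: U_def U_tilde_def L_def L_tilde_star_def Np_def Nq_def num_nodes_def
        intro!: carrier_matI)
  have colU: "col U j = r j \<cdot>\<^sub>v (Y j *\<^sub>v cvec b)" if j: "j < Np" for j
  proof -
    have inf_col: "cvec (\<rho>_inf \<cdot>\<^sub>v (mat_inv E *\<^sub>v b)) = complex_of_real \<rho>_inf \<cdot>\<^sub>v (F *\<^sub>v cvec b)"
      by (simp add: F_def of_real_hom.vec_hom_smult of_real_hom.mult_mat_vec_hom[OF invE(1) b])
    let ?us = "map (\<lambda>j. complex_of_real (\<rho> j) \<cdot>\<^sub>v
                (resolvent E A (\<i> * complex_of_real (\<zeta> j)) *\<^sub>v cvec b)) [0..<lp]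
      @ (if p_inf then [cvec (\<rho>_inf \<cdot>\<^sub>v (mat_inv E *\<^sub>v b))] else [])"
    have nth: "?us ! j = r j \<cdot>\<^sub>v (Y j *\<^sub>v cvec b)"
      unfolding nth_finite_nodes_then_infinity[OF j[unfolded Np_def]]
      by (simp add: inf_col r_def Y_def R_def z_def)
    have len: "j < length ?us"
      using j by (simp add: Np_def num_nodes_def split: if_splits)
    have "?us ! j \<in> carrier_vec n"
      unfolding nth using Yc[of j] bc by simp
    from col_mat_of_cols[OF len this] show ?thesis
      unfolding nth U_def U_tilde_def using E by simp
  qed
  have rowL: "row L k = f k \<cdot>\<^sub>v row_times (cvec c) (X k)" if k: "k < Nq" for k
  proof -
    have inf_row: "cvec (\<phi>_inf \<cdot>\<^sub>v row_times c (mat_inv E))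
        = complex_of_real \<phi>_inf \<cdot>\<^sub>v row_times (cvec c) F"
      by (simp add: F_def of_real_hom.vec_hom_smult cvec_row_times[OF c invE(1)])
    let ?ls = "map (\<lambda>k. complex_of_real (\<phi> k) \<cdot>\<^sub>v
                row_times (cvec c) (resolvent E A (\<i> * complex_of_real (\<omega> k)))) [0..<lq]
      @ (if q_inf then [cvec (\<phi>_inf \<cdot>\<^sub>v row_times c (mat_inv E))] else [])"
    have nth: "?ls ! k = f k \<cdot>\<^sub>v row_times (cvec c) (X k)"
      unfolding nth_finite_nodes_then_infinity[OF k[unfolded Nq_def]]
      by (simp add: inf_row f_def X_def R_def w_def)
    have len: "k < length ?ls"
      using k by (simp add: Nq_def num_nodes_def split: if_splits)
    have "?ls ! k \<in> carrier_vec n"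
      unfolding nth using row_times_carrier[OF Xc] by simp
    from mat_of_rows_row[OF len this] show ?thesis
      unfolding nth L_def L_tilde_star_def using E by simp
  qed

  have M: "(L * cmat A * U) $$ (k, j) =
      (if k < lq \<and> j < lp then
         - complex_of_real (\<phi> k) * complex_of_real (\<rho> j) *
           ((w k * H (w k) - z j * H (z j)) / (w k - z j))
       else if k < lq then
         complex_of_real (\<phi> k) * complex_of_real \<rho>_inf * (w k * H (w k) - M0)
       else if j < lp then
         complex_of_real \<phi>_inf * complex_of_real (\<rho> j) * (z j * H (z j) - M0)
       else complex_of_real \<phi>_inf * complex_of_real \<rho>_inf * M1)"
    if k: "k < Nq" and j: "j < Np" for k j
  proof -
    have "w k \<noteq> z j" if "k < lq" "j < lp"
      using assms(7) that by (simp add: w_def z_def)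
    then show ?thesis
      using entry_of_weighted_sandwich[OF Lc Ac Uc Xc Yc cc bc k j rowL[OF k] colU[OF j]]
      by (auto simp: \<beta>_def[symmetric] \<beta>_RAR \<beta>_RAF \<beta>_FAR \<beta>_FAF X_def Y_def f_def r_def
          simp del: assoc_mult_mat assoc_mult_mat_vec index_mult_mat(1))
  qed
  have h: "(L *\<^sub>v cvec b) $ k =
      (if k < lq then complex_of_real (\<phi> k) * H (w k) else complex_of_real \<phi>_inf * M0)"
    if k: "k < Nq" for k
  proof -
    have "(L *\<^sub>v cvec b) $ k = f k * (row_times (cvec c) (X k) \<bullet> cvec b)"
      using Lc k rowL[OF k] row_times_carrier[OF Xc, of "cvec c" k] bc by simp
    also have "\<dots> = f k * \<beta> (X k)"
      unfolding \<beta>_def using row_times_scalar_prod[OF cc Xc bc] by simp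
    finally show ?thesis
      by (auto simp: X_def f_def \<beta>_R \<beta>_F)
  qed
  have g: "row_times (cvec c) U $ j =
      (if j < lp then complex_of_real (\<rho> j) * H (z j) else complex_of_real \<rho>_inf * M0)"
    if j: "j < Np" for j
  proof -
    have "row_times (cvec c) U $ j = cvec c \<bullet> (r j \<cdot>\<^sub>v (Y j *\<^sub>v cvec b))"
      using Uc j colU[OF j] by (simp add: row_times_index)
    also have "\<dots> = r j * \<beta> (Y j)"
      unfolding \<beta>_def using cc Yc[of j] by (simp add: carrier_vecD)
    finally show ?thesis
      by (auto simp: Y_def r_def \<beta>_R \<beta>_F)
  qed
  have "L * cmat A * U \<in> carrier_mat Nq Np" "L *\<^sub>v cvec b \<in> carrier_vec Nq"
    "row_times (cvec c) U \<in> carrier_vec Np"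
    using Lc Ac Uc mult_mat_vec_carrier[OF Lc bc] row_times_carrier[OF Uc] by auto
  with Uc Lc M h g show ?thesis
    unfolding Let_def H_def M0_def M1_def Np_def Nq_def U_def L_def z_def w_def by blast
qed

end
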